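(* Let $\ell\in\mathbb{N}=\{1,2,\dots\}$, let $n_p^{(\ell+1)}$ be the $(\ell+1)$-th fixed point of the Josephus function $J_3$, and put $p:=\overline{m}_\ell$ and $q:=\overline{m}_{\ell+1}$, where $\overline{m}_j$ is the number of pure high extremal points of $J_3$ between the $j$-th and $(j+1)$-th fixed points. Assume $p\ge1$ and $q\ge1$. Let $$a_1:=\tfrac12(3^p-1),\qquad a_2:=\begin{cases}\tfrac23(2^q-1), & \text{if } q \text{ is even},\\ \tfrac23(2^{q-1}-1), & \text{if } q\text{ is odd}.\end{cases}$$ Then $n_p^{(\ell+1)}$ satisfies the system of congruences $$n_p^{(\ell+1)}\equiv a_1 \pmod{3^p},\qquad n_p^{(\ell+1)}\equiv a_2\pmod{2^q}.$$ Consequently, for any integers $x,y$ with $3^px+2^qy=1$, the number $z=a_1 2^q y+a_2 3^p x$ is the unique solution of this system modulo $3^p\cdot 2^q$, and $n_p^{(\ell+1)}\equiv z \pmod{3^p\cdot 2^q}$.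
   Context: Josephus function $J_3$: $n\ge 1$ people sit at a round table, numbered consecutively clockwise $1,\dots,n$. Counting begins at position $1$: skip two people and eliminate the third; continue clockwise among the remaining participants, always starting with the next person, skipping two and removing the third, until only one person remains. $J_3(n)$ is the (initial) position of this survivor. A high extremal point is a positive integer $n_e$ with $J_3(n_e)\in\{n_e-1,n_e\}$. If $J_3(n_e)=n_e$ it is a fixed point of $J_3$; if $J_3(n_e)=n_e-1$ it is a pure high extremal point. The fixed points of $J_3$, listed in increasing order, form the sequence $\{n_p^{(\ell)}\}_{\ell\in\mathbb{N}}$, with $n_p^{(1)}=1$; $\overline{m}_\ell$ denotes the number of pure high extremal points between $n_p^{(\ell)}$ and $n_p^{(\ell+1)}$. (The subscript $p$ in $n_p^{(\ell)}$ is only part of the notation and is unrelated to the integer $p=\overline{m}_\ell$.) Known result recalled from earlier work: the sequence of fixed points is infinite and is given by $n_p^{(1)}=1$ and, for every $\ell\in\mathbb{N}$, $$n_p^{(\ell+1)}=\frac{3^{\overline{m}_\ell}(3n_p^{(\ell)}+2)-2^{\overline{m}_\ell}}{2^{\overline{m}_\ell+1}},\qquad \overline{m}_\ell=\max\{m\in\mathbb{Z}_{+} : 2^m \text{ divides } 3n_p^{(\ell)}+2\},$$ where $\mathbb{Z}_+$ denotes the non-negative integers. *)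

theory Defs
  imports Main "HOL-Library.Infinite_Set" "HOL-Number_Theory.Cong"
begin

text \<open>A round table is the list of the remaining people in clockwise order, beginning with the
  person at whom the next count starts. One round moves the two skipped people to the back and
  removes the third, so the list again begins with the person following the eliminated one.
  When two people are left, \<^term>\<open>rotate 2\<close> is the identity: the first is counted twice
  and eliminated.\<close>

definition josephus3_round :: "nat list \<Rightarrow> nat list" where
  "josephus3_round xs = tl (rotate 2 xs)"

definition J3 :: "nat \<Rightarrow> nat" where
  "J3 n = hd ((josephus3_round ^^ (n - 1)) [1..<n + 1])"

definition high_extremal :: "nat \<Rightarrow> bool" where
  "high_extremal n \<longleftrightarrow> n \<ge> 1 \<and> J3 n \<in> {n - 1, n}"

definition J3_fixed_points :: "nat set" where
  "J3_fixed_points = {n. high_extremal n \<and> J3 n = n}"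

definition pure_high_extremal :: "nat \<Rightarrow> bool" where
  "pure_high_extremal n \<longleftrightarrow> high_extremal n \<and> J3 n = n - 1"

text \<open>The sequence of fixed points is indexed from \<open>1\<close>, whereas \<^const>\<open>enumerate\<close> is indexed
  from \<open>0\<close>; the value at index \<open>0\<close> is meaningless. The set of fixed points is infinite, so
  \<^const>\<open>enumerate\<close> does list it in increasing order.\<close>

definition fixed_point :: "nat \<Rightarrow> nat" where
  "fixed_point l = enumerate J3_fixed_points (l - 1)"

definition num_pure_high :: "nat \<Rightarrow> nat" where
  "num_pure_high l =
     card {n. fixed_point l < n \<and> n < fixed_point (l + 1) \<and> pure_high_extremal n}"

text \<open>The integer divisions in the residues \<open>a\<^sub>1\<close>, \<open>a\<^sub>2\<close> are exact.\<close>

lemma residue1_exact: "2 * ((3 ^ p - 1) div 2) = (3 ^ p - 1 :: int)"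
  by simp

lemma residue2_exact:
  assumes "even k"
  shows "3 * (2 * (2 ^ k - 1) div 3) = (2 * (2 ^ k - 1) :: int)"
proof -
  obtain j where k: "k = 2 * j"
    using assms by blast
  have "[(4::int) ^ j = 1 ^ j] (mod 3)"
    by (rule cong_pow) (simp add: cong_def)
  then have "(3::int) dvd 2 ^ k - 1"
    by (simp add: k power_mult cong_iff_dvd_diff)
  then have "(3::int) dvd 2 * (2 ^ k - 1)"
    by (rule dvd_mult)
  then show ?thesis
    by (rule dvd_mult_div_cancel)
qed

end

theory Submission imports Defs begin

text \<open>Removing the first victim and renumbering gives
  \<open>J3 (n + 1) = (J3 n + 2) mod (n + 1) + 1\<close>, so between high extremal points the value
  of \<^const>\<open>J3\<close> grows by 3 while its argument grows by 1. Tracing this climb by the parity of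
  the starting point shows that a pure point \<open>u\<close> is followed by a pure point \<open>v\<close> with
  \<open>2 * (v + 1) = 3 * (u + 1)\<close> if \<open>u\<close> is odd, and by a fixed point if \<open>u\<close> is even. Hence
  consecutive fixed points \<open>n < N\<close> with \<open>m\<close> pure points between them satisfy
  \<open>3 * n + 2 = 2 ^ m * r\<close> and \<open>2 * N + 1 = 3 ^ m * r\<close>. The second equation determines
  \<open>N\<close> modulo \<open>3 ^ p\<close>, the first one, taken for the next pair, modulo \<open>2 ^ q\<close>.\<close>

section \<open>The recurrence for \<open>J3\<close>\<close>

lemma josephus3_round_upt:
  "josephus3_round [1..<Suc n + 1] = map (\<lambda>i. (i + 2) mod Suc n + 1) [1..<n + 1]"
proof (rule nth_equalityI)
  fix i assume "i < length (josephus3_round [1..<Suc n + 1])"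
  then have i: "i < n"
    by (simp add: josephus3_round_def del: upt_Suc)
  have "josephus3_round [1..<Suc n + 1] ! i = rotate 2 [1..<Suc n + 1] ! Suc i"
    using i by (simp add: josephus3_round_def nth_tl del: upt_Suc)
  also have "\<dots> = [1..<Suc n + 1] ! ((2 + Suc i) mod Suc n)"
    using i by (subst nth_rotate) (simp_all del: upt_Suc)
  also have "\<dots> = (2 + Suc i) mod Suc n + 1"
    by (subst nth_upt) (simp_all del: upt_Suc add: Suc_leI)
  finally show "josephus3_round [1..<Suc n + 1] ! i
      = map (\<lambda>i. (i + 2) mod Suc n + 1) [1..<n + 1] ! i"
    using i by (simp del: upt_Suc add: add.commute)
qed (simp add: josephus3_round_def del: upt_Suc)

text \<open>A round only moves and drops positions, whatever the labels; so after the first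
  elimination the game is the one for \<open>n\<close> people, relabelled.\<close>

lemma funpow_josephus3_round_map:
  "(josephus3_round ^^ k) (map f xs) = map f ((josephus3_round ^^ k) xs)"
  by (induction k) (simp_all add: josephus3_round_def rotate_map map_tl)

lemma length_funpow_josephus3_round:
  "length ((josephus3_round ^^ k) xs) = length xs - k"
  by (induction k) (simp_all add: josephus3_round_def)

lemma J3_1: "J3 (Suc 0) = 1"
  by (simp add: J3_def)

lemma J3_Suc:
  assumes "n \<ge> 1"
  shows "J3 (Suc n) = (J3 n + 2) mod Suc n + 1"
proof -
  obtain k where k: "n = Suc k"
    using assms by (cases n) auto
  have "(josephus3_round ^^ k) [1..<n + 1] \<noteq> []"
    using length_funpow_josephus3_round[of k "[1..<n + 1]"] k
    by (auto simp del: upt_Suc simp flip: length_greater_0_conv)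
  moreover have "(josephus3_round ^^ n) [1..<Suc n + 1]
      = map (\<lambda>i. (i + 2) mod Suc n + 1) ((josephus3_round ^^ k) [1..<n + 1])"
    unfolding k funpow_Suc_right o_apply josephus3_round_upt funpow_josephus3_round_map ..
  ultimately show ?thesis
    by (simp add: J3_def k hd_map del: upt_Suc funpow.simps)
qed

lemma J3_ge_1: "n \<ge> 1 \<Longrightarrow> J3 n \<ge> 1"
  by (induction n rule: dec_induct) (simp_all add: J3_1 J3_Suc)

text \<open>The bound on \<open>k\<close> says exactly that \<open>mod\<close> in
  \<open>J3_Suc\<close> does not wrap during the \<open>k\<close> steps.\<close>

lemma J3_climb:
  assumes "n \<ge> 1" "J3 n + 2 * k \<le> n"
  shows "J3 (n + k) = J3 n + 3 * k"
  using assms(2)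
proof (induction k)
  case (Suc k)
  then show ?case
    using assms(1) by (simp add: J3_Suc)
qed simp

text \<open>Each step lowers the gap between argument and value by 2, so before the last step the
  gap is still at least 2.\<close>

lemma not_high_extremal_climb:
  assumes "n \<ge> 1" "J3 n + 2 * k \<le> n" "n \<le> j" "j < n + k"
  shows "\<not> high_extremal j"
proof -
  have "J3 j = J3 n + 3 * (j - n)"
    using J3_climb[of n "j - n"] assms by simp
  then show ?thesis
    using assms unfolding high_extremal_def by auto
qed

definition next_high_extremal :: "nat \<Rightarrow> nat \<Rightarrow> bool" where
  "next_high_extremal n v \<longleftrightarrow> n < v \<and> (\<forall>j. n < j \<and> j < v \<longrightarrow> \<not> high_extremal j)"

lemma climb_to_next:
  assumes "J3 (Suc n) + 2 * k \<le> Suc n"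
  shows "J3 (Suc n + k) = J3 (Suc n) + 3 * k" "next_high_extremal n (Suc n + k)"
  using J3_climb[of "Suc n" k] not_high_extremal_climb[of "Suc n" k] assms
  by (auto simp: next_high_extremal_def)

section \<open>From one high extremal point to the next\<close>

lemma fixed_point_iff: "n \<in> J3_fixed_points \<longleftrightarrow> n \<ge> 1 \<and> J3 n = n"
  by (auto simp: J3_fixed_points_def high_extremal_def)

lemma pure_high_extremal_iff: "pure_high_extremal n \<longleftrightarrow> n \<ge> 1 \<and> J3 n = n - 1"
  by (auto simp: pure_high_extremal_def high_extremal_def)

lemma pure_not_fixed: "pure_high_extremal n \<Longrightarrow> n \<notin> J3_fixed_points"
  by (auto simp: pure_high_extremal_iff fixed_point_iff)

lemma J3_Suc_fixed: "n \<in> J3_fixed_points \<Longrightarrow> J3 (Suc n) = 2"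
  by (simp add: fixed_point_iff J3_Suc mod_Suc)

lemma J3_Suc_pure: "pure_high_extremal n \<Longrightarrow> J3 (Suc n) = 1"
  by (simp add: pure_high_extremal_iff J3_Suc)

text \<open>Here and in the next three lemmas the climb starts at \<open>Suc n\<close> with value 2
  (fixed) or 1 (pure). The parity of the initial gap decides whether it ends at gap 0, a fixed
  point, or gap 1, a pure point.\<close>

lemma next_fixed_odd:
  assumes "2 * t + 1 \<in> J3_fixed_points"
  shows "3 * t + 2 \<in> J3_fixed_points" "next_high_extremal (2 * t + 1) (3 * t + 2)"
  using climb_to_next[of "2 * t + 1" t] J3_Suc_fixed[OF assms]
  by (simp_all add: fixed_point_iff)

lemma next_fixed_even:
  assumes "2 * t \<in> J3_fixed_points"
  shows "pure_high_extremal (3 * t)" "next_high_extremal (2 * t) (3 * t)"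
proof -
  have t: "t \<ge> 1"
    using assms by (simp add: fixed_point_iff)
  then have "Suc (2 * t) + (t - 1) = 3 * t" "2 + 3 * (t - 1) = 3 * t - 1"
    "2 + 2 * (t - 1) \<le> Suc (2 * t)"
    by simp_all
  then show "pure_high_extremal (3 * t)" "next_high_extremal (2 * t) (3 * t)"
    using climb_to_next[of "2 * t" "t - 1"] J3_Suc_fixed[OF assms] t
    by (simp_all add: pure_high_extremal_iff)
qed

lemma next_pure_odd:
  assumes "pure_high_extremal (2 * t + 1)"
  shows "pure_high_extremal (3 * t + 2)" "next_high_extremal (2 * t + 1) (3 * t + 2)"
  using climb_to_next[of "2 * t + 1" t] J3_Suc_pure[OF assms]
  by (simp_all add: pure_high_extremal_iff)

lemma next_pure_even:
  assumes "pure_high_extremal (2 * t)"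
  shows "3 * t + 1 \<in> J3_fixed_points" "next_high_extremal (2 * t) (3 * t + 1)"
  using climb_to_next[of "2 * t" t] J3_Suc_pure[OF assms]
  by (simp_all add: fixed_point_iff)

section \<open>From one fixed point to the next\<close>

definition next_fixed :: "nat \<Rightarrow> nat \<Rightarrow> nat \<Rightarrow> bool" where
  "next_fixed n m N \<longleftrightarrow> n < N \<and> N \<in> J3_fixed_points
     \<and> (\<forall>j. n < j \<and> j < N \<longrightarrow> j \<notin> J3_fixed_points)
     \<and> card {j. n < j \<and> j < N \<and> pure_high_extremal j} = m"

lemma next_fixed_0:
  assumes "N \<in> J3_fixed_points" "next_high_extremal n N"
  shows "next_fixed n 0 N"
proof -
  have "{j. n < j \<and> j < N \<and> pure_high_extremal j} = {}"
    using assms by (auto simp: next_high_extremal_def pure_high_extremal_def)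
  moreover have "\<forall>j. n < j \<and> j < N \<longrightarrow> j \<notin> J3_fixed_points"
    using assms by (auto simp: next_high_extremal_def J3_fixed_points_def)
  ultimately show ?thesis
    using assms by (auto simp: next_fixed_def next_high_extremal_def)
qed

text \<open>The start of \<open>next_fixed\<close> may itself be pure, so a chain of pure points can
  be built up from its far end.\<close>

lemma next_fixed_Suc:
  assumes "pure_high_extremal v" "next_high_extremal n v" "next_fixed v m N"
  shows "next_fixed n (Suc m) N"
proof -
  have less: "n < v" "v < N"
    using assms by (auto simp: next_high_extremal_def next_fixed_def)
  have "{j. n < j \<and> j < N \<and> pure_high_extremal j}
      = insert v {j. v < j \<and> j < N \<and> pure_high_extremal j}"
    using assms(1,2) less
    by (auto simp: next_high_extremal_def pure_high_extremal_def not_less_iff_gr_or_eq)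
  then have "card {j. n < j \<and> j < N \<and> pure_high_extremal j} = Suc m"
    using assms(3) by (simp add: next_fixed_def)
  moreover have "j \<notin> J3_fixed_points" if "n < j" "j < N" for j
  proof (cases j v rule: linorder_cases)
    case less
    with that assms(2) show ?thesis
      by (simp add: next_high_extremal_def J3_fixed_points_def)
  next
    case equal
    with assms(1) show ?thesis
      by (simp add: pure_not_fixed)
  next
    case greater
    with that assms(3) show ?thesis
      by (simp add: next_fixed_def)
  qed
  ultimately show ?thesis
    using assms(3) less by (simp add: next_fixed_def)
qed

text \<open>Each step between pure points trades a factor 2 of \<open>n + 1\<close> for a factor 3.
  Once \<open>n + 1\<close> is odd, the step to the fixed point supplies the last factor 3.\<close>

lemma next_fixed_from_pure:
  assumes "pure_high_extremal n" "n + 1 = 2 ^ i * r" "odd r"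
  shows "\<exists>N. next_fixed n i N \<and> 2 * N + 1 = 3 ^ Suc i * r"
  using assms
proof (induction i arbitrary: n r)
  case 0
  then have "even n"
    by (metis even_plus_one_iff mult_1 power_0)
  then obtain t where "n = 2 * t" ..
  then show ?case
    using 0 next_pure_even[of t] next_fixed_0
    by (intro exI[of _ "3 * t + 1"]) auto
next
  case (Suc i)
  then have "odd n"
    by (metis dvd_mult2 dvd_triv_left even_plus_one_iff power_Suc)
  then obtain t where t: "n = 2 * t + 1" ..
  have "t + 1 = 2 ^ i * r"
    using Suc.prems t by simp
  then have "(3 * t + 2) + 1 = 2 ^ i * (3 * r)"
    by (simp add: algebra_simps)
  then obtain N where "next_fixed (3 * t + 2) i N" "2 * N + 1 = 3 ^ Suc i * (3 * r)"
    using Suc.IH[of "3 * t + 2" "3 * r"] Suc.prems next_pure_odd[of t] t by auto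
  then show ?case
    using next_fixed_Suc Suc.prems next_pure_odd[of t] t by (intro exI[of _ N]) auto
qed

lemma next_fixed_from_fixed:
  assumes "n \<in> J3_fixed_points"
  shows "\<exists>m N r. next_fixed n m N \<and> 3 * n + 2 = 2 ^ m * r \<and> 2 * N + 1 = 3 ^ m * r"
proof (cases "even n")
  case True
  then obtain t where t: "n = 2 * t" ..
  obtain i r where r: "3 * t + 1 = 2 ^ i * r" "odd r"
    \<comment> \<open>The next point \<open>3 * t\<close> is pure, and \<open>3 * n + 2\<close> is
      twice \<open>3 * t + 1\<close>; hence the exponent \<open>Suc i\<close> below.\<close>
    by (rule multiplicity_decompose'[of "3 * t + 1" 2]) simp_all
  then obtain N where "next_fixed (3 * t) i N" "2 * N + 1 = 3 ^ Suc i * r"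
    using next_fixed_from_pure[of "3 * t"] next_fixed_even[of t] assms t by auto
  then show ?thesis
    using next_fixed_Suc next_fixed_even[of t] assms t r
    by (intro exI[of _ "Suc i"] exI[of _ N] exI[of _ r]) auto
next
  case False
  then obtain t where t: "n = 2 * t + 1" ..
  then show ?thesis
    using next_fixed_0 next_fixed_odd[of t] assms
    by (intro exI[of _ 0] exI[of _ "3 * t + 2"] exI[of _ "6 * t + 5"]) auto
qed

text \<open>A largest fixed point would still have a successor. Infinitude is what lets
  \<open>enumerate\<close> list the set in increasing order.\<close>

lemma infinite_J3_fixed_points: "infinite J3_fixed_points"
proof
  assume fin: "finite J3_fixed_points"
  have "1 \<in> J3_fixed_points"
    by (simp add: fixed_point_iff J3_1)
  then have "Max J3_fixed_points \<in> J3_fixed_points"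
    using fin Max_in by blast
  then obtain N where "Max J3_fixed_points < N" "N \<in> J3_fixed_points"
    using next_fixed_from_fixed by (auto simp: next_fixed_def)
  then show False
    using fin by (simp add: leD)
qed

text \<open>Eliminating \<open>r\<close> gives the known recursion for the fixed points; the
  congruences come more directly from the two factorizations.\<close>

lemma fixed_point_step:
  assumes "l \<ge> 1"
  obtains r where "3 * fixed_point l + 2 = 2 ^ num_pure_high l * r"
    and "2 * fixed_point (l + 1) + 1 = 3 ^ num_pure_high l * r"
proof -
  have "fixed_point l \<in> J3_fixed_points"
    by (simp add: fixed_point_def enumerate_in_set infinite_J3_fixed_points)
  then obtain m N r where N: "next_fixed (fixed_point l) m N"
    and r: "3 * fixed_point l + 2 = 2 ^ m * r" "2 * N + 1 = 3 ^ m * r"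
    using next_fixed_from_fixed by blast
  have "fixed_point (l + 1) = (LEAST s. s \<in> J3_fixed_points \<and> fixed_point l < s)"
    using enumerate_Suc''[OF infinite_J3_fixed_points, of "l - 1"] assms
    by (simp add: fixed_point_def)
  also have "\<dots> = N"
    using N by (intro Least_equality) (auto simp: next_fixed_def not_less[symmetric])
  finally have "fixed_point (l + 1) = N" .
  moreover from this have "num_pure_high l = m"
    using N by (simp add: num_pure_high_def next_fixed_def)
  ultimately show thesis
    using r that by simp
qed

theorem mainTheorem2:
  fixes l p q :: nat and a1 a2 :: int
  assumes "l \<ge> 1"
    and "p = num_pure_high l" and "q = num_pure_high (l + 1)"
    and "p \<ge> 1" and "q \<ge> 1"
    and "a1 = (3 ^ p - 1) div 2"
    and "a2 = (if even q then 2 * (2 ^ q - 1) div 3 else 2 * (2 ^ (q - 1) - 1) div 3)"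
  shows "[int (fixed_point (l + 1)) = a1] (mod 3 ^ p)
    \<and> [int (fixed_point (l + 1)) = a2] (mod 2 ^ q)
    \<and> (\<forall>x y z :: int. 3 ^ p * x + 2 ^ q * y = 1 \<longrightarrow> z = a1 * 2 ^ q * y + a2 * 3 ^ p * x \<longrightarrow>
          [z = a1] (mod 3 ^ p) \<and> [z = a2] (mod 2 ^ q)
        \<and> (\<forall>w :: int. [w = a1] (mod 3 ^ p) \<and> [w = a2] (mod 2 ^ q) \<longrightarrow>
              [w = z] (mod 3 ^ p * 2 ^ q))
        \<and> [int (fixed_point (l + 1)) = z] (mod 3 ^ p * 2 ^ q))"
proof -
  define N where "N = int (fixed_point (l + 1))"
  obtain r where "2 * fixed_point (l + 1) + 1 = 3 ^ p * r"
    using fixed_point_step[of l] assms(1,2) by metis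
  then have r: "2 * N + 1 = 3 ^ p * int r"
    unfolding N_def by (metis of_nat_1 of_nat_add of_nat_mult of_nat_numeral of_nat_power)
  obtain s where "3 * fixed_point (l + 1) + 2 = 2 ^ q * s"
    using fixed_point_step[of "l + 1"] assms(3) by auto
  then have s: "3 * N + 2 = 2 ^ q * int s"
    unfolding N_def by (metis of_nat_add of_nat_mult of_nat_numeral of_nat_power)
  have "2 * (N - a1) = 3 ^ p * (int r - 1)"
    using r residue1_exact[of p] assms(6) by (simp add: algebra_simps)
  then have "3 ^ p dvd 2 * (N - a1)"
    by simp
  then have N1: "[N = a1] (mod 3 ^ p)"
    unfolding cong_iff_dvd_diff by (subst (asm) coprime_dvd_mult_right_iff) simp_all
  \<comment> \<open>In both parities \<open>3 * a2\<close> is -2 modulo \<open>2 ^ q\<close>, as is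
    \<open>3 * N\<close>; the factor 3 is then cancelled, being coprime to
    \<open>2 ^ q\<close>.\<close>
  have "3 * a2 = 2 * (2 ^ q - 1) \<or> 3 * a2 = 2 ^ q - 2"
  proof (cases "even q")
    case True
    then show ?thesis
      using residue2_exact assms(7) by simp
  next
    case False
    moreover from this have "(2::int) * 2 ^ (q - 1) = 2 ^ q"
      by (simp add: odd_pos flip: power_Suc)
    ultimately show ?thesis
      using residue2_exact[of "q - 1"] assms(7) by simp
  qed
  then have "3 * (N - a2) = 2 ^ q * (int s - 2) \<or> 3 * (N - a2) = 2 ^ q * (int s - 1)"
    using s by (auto simp: algebra_simps)
  then have "2 ^ q dvd 3 * (N - a2)"
    by (metis dvd_triv_left)
  then have N2: "[N = a2] (mod 2 ^ q)"
    unfolding cong_iff_dvd_diff by (subst (asm) coprime_dvd_mult_right_iff) simp_all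
  have unique: "[w = z] (mod 3 ^ p * 2 ^ q)"
    if "[w = a1] (mod 3 ^ p)" "[w = a2] (mod 2 ^ q)" "[z = a1] (mod 3 ^ p)" "[z = a2] (mod 2 ^ q)"
    for w z :: int
    using that by (intro coprime_cong_mult) (auto intro: cong_trans cong_sym)
  have sol: "[z = a1] (mod 3 ^ p) \<and> [z = a2] (mod 2 ^ q)"
    if "3 ^ p * x + 2 ^ q * y = 1" "z = a1 * 2 ^ q * y + a2 * 3 ^ p * x" for x y z :: int
  proof -
    \<comment> \<open>Replacing 1 by its Bezout expression makes \<open>z - a1\<close> and
      \<open>z - a2\<close> factor through the moduli.\<close>
    have "z - a * 1 = a1 * 2 ^ q * y + a2 * 3 ^ p * x - a * (3 ^ p * x + 2 ^ q * y)" for a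
      using that by simp
    from this[of a1] this[of a2]
    have "z - a1 = 3 ^ p * (x * (a2 - a1))" "z - a2 = 2 ^ q * (y * (a1 - a2))"
      by (simp_all add: algebra_simps)
    then show ?thesis
      by (simp add: cong_iff_dvd_diff)
  qed
  show ?thesis
    using N1 N2 sol unique unfolding N_def by blast
qed

end
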